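(* Let $X$ be a topological space. The following are equivalent: (1) $X$ is injectively core compact; (2) $[X,\$]$ is diagonal; (3) $[X,\$]$ is $\mathbb{F}_1$-diagonal.
   Context: For a topological space $X$, $\mathcal{O}_X$ is the set of open subsets of $X$. $[X,\$]$ denotes the convergence space $\mathcal{O}_X$ (identified with the continuous maps from $X$ to the Sierpiński space $\$$) with the convergence of filters given by $U\in\lim_{[X,\$]}\mathcal{F}$ iff $U\subseteq\bigcup_{F\in\mathcal{F}}\operatorname{int}\left(\bigcap_{O\in F}O\right)$. $\mathbb{F}Y$ denotes the set of filters on a set $Y$. A convergence space $Y$ is diagonal if for every selection $\mathcal{S}[\cdot]:Y\to\mathbb{F}Y$ with $y\in\lim_Y\mathcal{S}[y]$ for all $y\in Y$ and every filter $\mathcal{F}$ with $y_0\in\lim_Y\mathcal{F}$, the filter $\mathcal{S}[\mathcal{F}]:=\bigcup_{F\in\mathcal{F}}\bigcap_{y\in F}\mathcal{S}[y]$ converges to $y_0$. $Y$ is $\mathbb{F}_1$-diagonal if this property holds whenever $\mathcal{F}$ is additionally a principal filter (i.e. $\mathcal{F}=\{B\subseteq Y: A\subseteq B\}$ for some nonempty $A\subseteq Y$). For a filter $\mathcal{H}$ on the topological space $X$, $\operatorname{adh}\mathcal{H}=\bigcap_{H\in\mathcal{H}}\operatorname{cl}H$. For a family $\mathbb{H}$ of filters, $\bigwedge_{\mathcal{H}\in\mathbb{H}}\mathcal{H}=\bigcap_{\mathcal{H}\in\mathbb{H}}\mathcal{H}$ is its infimum. $\mathcal{O}(x)$ (resp.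 $\mathcal{O}(U)$) is the set of open subsets of $X$ containing the point $x$ (resp. the set $U$). A topological space $X$ is injectively core compact if for every $x\in X$, every $U\in\mathcal{O}(x)$ and every family $\mathbb{H}$ of filters on $X$ for which there is an injection $\theta:\mathbb{H}\to\mathcal{O}(U)$ satisfying $\operatorname{adh}\mathcal{H}\cap\theta(\mathcal{H})=\emptyset$ for each $\mathcal{H}\in\mathbb{H}$, one has $x\notin\operatorname{adh}\bigwedge_{\mathcal{H}\in\mathbb{H}}\mathcal{H}$. (For empty $\mathbb{H}$ the infimum is the family of all subsets of $X$, with empty adherence.) *)

theory Defs
  imports "HOL-Analysis.Analysis"
begin

section \<open>Filters on a carrier set\<close>

text \<open>
  A filter on a set \<open>Y\<close> is rendered as a proper filter of type \<open>'b filter\<close> below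
  \<open>principal Y\<close>, and \<open>filter_sets Y\<close> turns it into the family of its members, which are
  subsets of \<open>Y\<close>. The order of the type \<open>'b filter\<close> is the reverse of inclusion of families,
  so unions of families are \<open>INF\<close> and intersections of families (the infima of the
  mathematical literature) are \<open>SUP\<close>, \<open>Sup\<close>; the family of all subsets is \<open>bot\<close>.
\<close>

definition filters_on :: "'b set \<Rightarrow> 'b filter set" where
  "filters_on Y = {F. F \<noteq> bot \<and> F \<le> principal Y}"

definition filter_sets :: "'b set \<Rightarrow> 'b filter \<Rightarrow> 'b set set" where
  "filter_sets Y F = {A. A \<subseteq> Y \<and> (\<forall>\<^sub>F y in F. y \<in> A)}"

definition contour_filter :: "'b set \<Rightarrow> ('b \<Rightarrow> 'b filter) \<Rightarrow> 'b filter \<Rightarrow> 'b filter" where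
  "contour_filter Y S F = (INF A\<in>filter_sets Y F. SUP y\<in>A. S y)"

lemma filter_sets_contour_filter:
  assumes F: "F \<in> filters_on Y"
  shows "filter_sets Y (contour_filter Y S F) =
           (\<Union>A\<in>filter_sets Y F. \<Inter>y\<in>A. filter_sets Y (S y))"
proof -
  have Y: "Y \<in> filter_sets Y F"
    using F by (auto simp: filters_on_def filter_sets_def le_principal)
  have ne: "A \<noteq> {}" if "A \<in> filter_sets Y F" for A
    using that F by (auto simp: filters_on_def filter_sets_def eventually_False)
  have dir: "\<exists>C\<in>filter_sets Y F. (SUP y\<in>C. S y) \<le> inf (SUP y\<in>A. S y) (SUP y\<in>B. S y)"
    if "A \<in> filter_sets Y F" "B \<in> filter_sets Y F" for A B
  proof
    show "A \<inter> B \<in> filter_sets Y F"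
      using that by (simp add: filter_sets_def eventually_conj_iff le_infI1)
    show "(SUP y\<in>A \<inter> B. S y) \<le> inf (SUP y\<in>A. S y) (SUP y\<in>B. S y)"
      by (intro le_infI SUP_subset_mono) simp_all
  qed
  have ev: "eventually P (contour_filter Y S F) \<longleftrightarrow>
              (\<exists>A\<in>filter_sets Y F. \<forall>y\<in>A. eventually P (S y))" for P
  proof -
    have "eventually P (contour_filter Y S F) \<longleftrightarrow>
            (\<exists>A\<in>filter_sets Y F. eventually P (SUP y\<in>A. S y))"
      unfolding contour_filter_def using Y dir by (intro eventually_INF_base) blast+
    then show ?thesis
      by (simp add: eventually_Sup)
  qed
  show ?thesis
  proof (intro set_eqI iffI)
    fix B assume "B \<in> filter_sets Y (contour_filter Y S F)"
    then have "B \<subseteq> Y" "\<forall>\<^sub>F z in contour_filter Y S F. z \<in> B"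
      by (simp_all add: filter_sets_def)
    then obtain A where "A \<in> filter_sets Y F" "\<forall>y\<in>A. \<forall>\<^sub>F z in S y. z \<in> B"
      unfolding ev by blast
    moreover from this \<open>B \<subseteq> Y\<close> have "B \<in> filter_sets Y (S y)" if "y \<in> A" for y
      using that unfolding filter_sets_def by simp
    ultimately show "B \<in> (\<Union>A\<in>filter_sets Y F. \<Inter>y\<in>A. filter_sets Y (S y))"
      by blast
  next
    fix B assume "B \<in> (\<Union>A\<in>filter_sets Y F. \<Inter>y\<in>A. filter_sets Y (S y))"
    then obtain A where A: "A \<in> filter_sets Y F" "\<And>y. y \<in> A \<Longrightarrow> B \<in> filter_sets Y (S y)"
      by blast
    with ne obtain y where "y \<in> A" by blast
    with A have "B \<subseteq> Y" by (simp add: filter_sets_def)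
    moreover have "\<forall>y\<in>A. \<forall>\<^sub>F z in S y. z \<in> B"
      using A(2) by (simp add: filter_sets_def)
    then have "\<forall>\<^sub>F z in contour_filter Y S F. z \<in> B"
      unfolding ev using A(1) by blast
    ultimately show "B \<in> filter_sets Y (contour_filter Y S F)"
      by (simp add: filter_sets_def)
  qed
qed

section \<open>Diagonal convergence spaces\<close>

text \<open>
  A convergence on \<open>Y\<close> is given by its limit operator \<open>L\<close>, where \<open>L F\<close> is the set of
  limits of the filter \<open>F\<close>.
\<close>

definition selection :: "'b set \<Rightarrow> ('b filter \<Rightarrow> 'b set) \<Rightarrow> ('b \<Rightarrow> 'b filter) \<Rightarrow> bool" where
  "selection Y L S \<longleftrightarrow> (\<forall>y\<in>Y. S y \<in> filters_on Y \<and> y \<in> L (S y))"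

definition diagonal :: "'b set \<Rightarrow> ('b filter \<Rightarrow> 'b set) \<Rightarrow> bool" where
  "diagonal Y L \<longleftrightarrow>
     (\<forall>S. selection Y L S \<longrightarrow>
       (\<forall>F\<in>filters_on Y. \<forall>y\<in>Y. y \<in> L F \<longrightarrow> y \<in> L (contour_filter Y S F)))"

definition F1_diagonal :: "'b set \<Rightarrow> ('b filter \<Rightarrow> 'b set) \<Rightarrow> bool" where
  "F1_diagonal Y L \<longleftrightarrow>
     (\<forall>S. selection Y L S \<longrightarrow>
       (\<forall>A. A \<subseteq> Y \<and> A \<noteq> {} \<longrightarrow>
         (\<forall>y\<in>Y. y \<in> L (principal A) \<longrightarrow> y \<in> L (contour_filter Y S (principal A)))))"

section \<open>The convergence space of open sets\<close>

definition opens :: "'a topology \<Rightarrow> 'a set set" where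
  "opens X = {U. openin X U}"

text \<open>
  An empty intersection would be \<open>UNIV\<close> instead of \<open>topspace X\<close>, which has the same
  interior in \<open>X\<close>.
\<close>

definition lim_opens :: "'a topology \<Rightarrow> 'a set filter \<Rightarrow> 'a set set" where
  "lim_opens X F =
     {U \<in> opens X. U \<subseteq> (\<Union>\<A>\<in>filter_sets (opens X) F. X interior_of (\<Inter>\<A>))}"

section \<open>Injective core compactness\<close>

definition adh :: "'a topology \<Rightarrow> 'a filter \<Rightarrow> 'a set" where
  "adh X H = (\<Inter>A\<in>filter_sets (topspace X) H. X closure_of A)"

definition open_nhds :: "'a topology \<Rightarrow> 'a set \<Rightarrow> 'a set set" where
  "open_nhds X U = {V. openin X V \<and> U \<subseteq> V}"

definition injectively_core_compact :: "'a topology \<Rightarrow> bool" where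
  "injectively_core_compact X \<longleftrightarrow>
     (\<forall>x\<in>topspace X. \<forall>U\<in>open_nhds X {x}. \<forall>\<H>\<subseteq>filters_on (topspace X).
       (\<exists>\<theta>. inj_on \<theta> \<H> \<and> \<theta> ` \<H> \<subseteq> open_nhds X U \<and> (\<forall>H\<in>\<H>. adh X H \<inter> \<theta> H = {}))
         \<longrightarrow> x \<notin> adh X (Sup \<H>))"

end

theory Submission
  imports Defs
begin

text \<open>
  Both kinds of filters in play are seen by the theorem only through an ideal of open sets. A filter
  on \<open>opens X\<close> yields the open sets that are eventually minorants of its elements, and it
  converges to \<open>U\<close> iff these minorants cover \<open>U\<close>. A filter \<open>H\<close> on \<open>topspace X\<close> yields the
  open sets that it eventually avoids, and their union is the complement of \<open>adh X H\<close>. Every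
  ideal of open sets arises from a filter on \<open>opens X\<close> and (up to properness) from a filter on
  \<open>topspace X\<close>, so filters of the two kinds can be exchanged: a filter converging to \<open>V\<close> in
  \<open>[X,$]\<close> becomes a filter whose adherence misses \<open>V\<close>, and conversely. On both sides, passing to
  the infimum of a family of filters intersects the ideals.

  If \<open>X\<close> is injectively core compact, \<open>S\<close> is a selection and \<open>F\<close> converges to a neighbourhood
  of \<open>x\<close>, then some member \<open>A\<close> of \<open>F\<close> consists of supersets of an open \<open>W\<close> containing \<open>x\<close>.
  The filters on \<open>topspace X\<close> exchanged for the \<open>S V\<close> with \<open>V \<in> A\<close> form a family to which
  injective core compactness applies with \<open>U = W\<close>. It gives an open set around \<open>x\<close> lying in the
  ideals of all \<open>S V\<close> at once, hence in the ideal of the contour filter.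

  Conversely, given \<open>\<H>\<close> and an injection \<open>\<theta>\<close> into the open supersets of \<open>U\<close>, the exchange of
  \<open>H\<close> is a filter converging to \<open>\<theta> H\<close>. Injectivity of \<open>\<theta>\<close> is exactly what allows it to be used
  as the value of a selection at \<open>\<theta> H\<close>. The principal filter of \<open>\<theta> ` \<H>\<close> converges to \<open>U\<close>,
  and the diagonal property for this principal filter alone gives an open set around \<open>x\<close> avoided
  by all filters in \<open>\<H>\<close>.
\<close>

section \<open>Ideals of open sets induced by filters\<close>

definition minorants :: "'a topology \<Rightarrow> 'a set filter \<Rightarrow> 'a set set" where
  "minorants X G = {W. openin X W \<and> (\<forall>\<^sub>F V in G. W \<subseteq> V)}"

definition avoided :: "'a topology \<Rightarrow> 'a filter \<Rightarrow> 'a set set" where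
  "avoided X H = {W. openin X W \<and> (\<forall>\<^sub>F y in H. y \<notin> W)}"

definition open_ideal :: "'a topology \<Rightarrow> 'a set set \<Rightarrow> bool" where
  "open_ideal X \<W> \<longleftrightarrow> \<W> \<subseteq> opens X \<and> {} \<in> \<W> \<and> (\<forall>V\<in>\<W>. \<forall>W\<in>\<W>. V \<union> W \<in> \<W>) \<and>
     (\<forall>W\<in>\<W>. \<forall>V. openin X V \<and> V \<subseteq> W \<longrightarrow> V \<in> \<W>)"

lemma open_ideal_minorants: "open_ideal X (minorants X G)"
proof -
  have "V \<union> W \<in> minorants X G" if VW: "V \<in> minorants X G" "W \<in> minorants X G" for V W
  proof -
    have "\<forall>\<^sub>F B in G. V \<subseteq> B" "\<forall>\<^sub>F B in G. W \<subseteq> B"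
      using VW by (simp_all add: minorants_def)
    then have "\<forall>\<^sub>F B in G. V \<union> W \<subseteq> B"
      by eventually_elim blast
    then show ?thesis
      using VW openin_Un[of X V W] unfolding minorants_def by blast
  qed
  moreover have "V \<in> minorants X G" if "W \<in> minorants X G" "openin X V" "V \<subseteq> W" for V W
  proof -
    have "\<forall>\<^sub>F B in G. W \<subseteq> B"
      using that(1) by (simp add: minorants_def)
    then have "\<forall>\<^sub>F B in G. V \<subseteq> B"
      by eventually_elim (use that(3) in blast)
    then show ?thesis
      using that(2) by (simp add: minorants_def)
  qed
  moreover have "{} \<in> minorants X G"
    unfolding minorants_def
    by (intro CollectI conjI openin_empty always_eventually allI empty_subsetI)
  moreover have "minorants X G \<subseteq> opens X"
    by (auto simp: minorants_def opens_def)
  ultimately show ?thesis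
    by (simp add: open_ideal_def)
qed

lemma open_ideal_avoided: "open_ideal X (avoided X H)"
proof -
  have "\<forall>\<^sub>F y in H. y \<notin> V" if "\<forall>\<^sub>F y in H. y \<notin> W" "V \<subseteq> W" for V W
    using that(1) by eventually_elim (use that(2) in blast)
  then show ?thesis
    by (auto simp: open_ideal_def avoided_def opens_def eventually_conj_iff)
qed

lemma eventually_in_carrier:
  assumes "F \<le> principal Y" "eventually P F"
  shows "{y \<in> Y. P y} \<in> filter_sets Y F"
  using assms by (auto simp: filter_sets_def le_principal eventually_conj_iff)

text \<open>
  The interior of \<open>\<Inter>\<A>\<close> is the largest open minorant of the family \<open>\<A>\<close>.
\<close>

lemma mem_lim_opens_iff:
  assumes F: "F \<le> principal (opens X)"
  shows "U \<in> lim_opens X F \<longleftrightarrow> openin X U \<and> U \<subseteq> \<Union>(minorants X F)"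
proof -
  have "(\<Union>\<A>\<in>filter_sets (opens X) F. X interior_of (\<Inter>\<A>)) = \<Union>(minorants X F)"
  proof (intro equalityI subsetI)
    fix x assume "x \<in> (\<Union>\<A>\<in>filter_sets (opens X) F. X interior_of (\<Inter>\<A>))"
    then obtain \<A> where \<A>: "\<A> \<in> filter_sets (opens X) F" and x: "x \<in> X interior_of (\<Inter>\<A>)"
      by blast
    have "\<forall>V\<in>\<A>. X interior_of (\<Inter>\<A>) \<subseteq> V"
      using interior_of_subset[of X "\<Inter>\<A>"] by blast
    then have "\<forall>\<^sub>F V in F. X interior_of (\<Inter>\<A>) \<subseteq> V"
      using \<A> unfolding filter_sets_def by (auto elim!: eventually_mono)
    then show "x \<in> \<Union>(minorants X F)"
      using x openin_interior_of[of X "\<Inter>\<A>"] unfolding minorants_def by blast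
  next
    fix x assume "x \<in> \<Union>(minorants X F)"
    then obtain W where W: "openin X W" "\<forall>\<^sub>F V in F. W \<subseteq> V" "x \<in> W"
      by (auto simp: minorants_def)
    have "W \<subseteq> X interior_of (\<Inter>{V \<in> opens X. W \<subseteq> V})"
      using W(1) by (intro interior_of_maximal) auto
    then show "x \<in> (\<Union>\<A>\<in>filter_sets (opens X) F. X interior_of (\<Inter>\<A>))"
      using eventually_in_carrier[OF F W(2)] W(3) by blast
  qed
  then show ?thesis
    by (simp add: lim_opens_def opens_def)
qed

text \<open>
  A point is adherent to \<open>H\<close> iff no open set around it is eventually avoided: the complement of an
  avoided open set is a member of \<open>H\<close>, and any member whose closure misses the point lies in such
  a complement.
\<close>

lemma adh_eq_Diff_avoided:
  assumes H: "H \<le> principal (topspace X)"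
  shows "adh X H = topspace X - \<Union>(avoided X H)"
proof (intro equalityI subsetI)
  fix x assume x: "x \<in> adh X H"
  have "topspace X \<in> filter_sets (topspace X) H"
    using H by (simp add: filter_sets_def le_principal)
  then have xX: "x \<in> topspace X"
    using x unfolding adh_def by auto
  have "x \<notin> W" if "W \<in> avoided X H" for W
  proof
    assume "x \<in> W"
    have "{y \<in> topspace X. y \<notin> W} \<in> filter_sets (topspace X) H"
      using that by (intro eventually_in_carrier[OF H]) (simp add: avoided_def)
    then have "x \<in> X closure_of {y \<in> topspace X. y \<notin> W}"
      using x unfolding adh_def by blast
    then show False
      using that \<open>x \<in> W\<close> unfolding in_closure_of avoided_def by blast
  qed
  then show "x \<in> topspace X - \<Union>(avoided X H)"
    using xX by blast
next
  fix x assume x: "x \<in> topspace X - \<Union>(avoided X H)"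
  have "x \<in> X closure_of A" if "A \<in> filter_sets (topspace X) H" for A
  proof (rule ccontr)
    assume "x \<notin> X closure_of A"
    then obtain W where W: "x \<in> W" "openin X W" "\<forall>y\<in>A. y \<notin> W"
      using x unfolding in_closure_of by blast
    have "\<forall>\<^sub>F y in H. y \<notin> W"
      using that W(3) by (auto simp: filter_sets_def elim: eventually_mono)
    then show False
      using x W(1,2) by (auto simp: avoided_def)
  qed
  then show "x \<in> adh X H"
    unfolding adh_def by blast
qed

section \<open>Filters induced by ideals of open sets\<close>

definition complement_filter :: "'a topology \<Rightarrow> 'a set set \<Rightarrow> 'a filter" where
  "complement_filter X \<W> = (INF W\<in>\<W>. principal (topspace X - W))"

definition superset_filter :: "'a topology \<Rightarrow> 'a set set \<Rightarrow> 'a set filter" where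
  "superset_filter X \<W> = (INF W\<in>\<W>. principal {V \<in> opens X. W \<subseteq> V})"

lemma eventually_complement_filter:
  assumes "open_ideal X \<W>"
  shows "eventually P (complement_filter X \<W>) \<longleftrightarrow> (\<exists>W\<in>\<W>. \<forall>y\<in>topspace X - W. P y)"
proof -
  have "\<exists>C\<in>\<W>. principal (topspace X - C)
          \<le> inf (principal (topspace X - A)) (principal (topspace X - B))"
    if "A \<in> \<W>" "B \<in> \<W>" for A B
    using that assms by (intro bexI[of _ "A \<union> B"]) (auto simp: open_ideal_def)
  moreover have "\<W> \<noteq> {}"
    using assms by (auto simp: open_ideal_def)
  ultimately have "eventually P (complement_filter X \<W>) \<longleftrightarrow>
      (\<exists>W\<in>\<W>. eventually P (principal (topspace X - W)))"
    unfolding complement_filter_def by (intro eventually_INF_base)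
  then show ?thesis
    by (auto simp: eventually_principal)
qed

lemma eventually_superset_filter:
  assumes "open_ideal X \<W>"
  shows "eventually P (superset_filter X \<W>) \<longleftrightarrow> (\<exists>W\<in>\<W>. \<forall>V\<in>opens X. W \<subseteq> V \<longrightarrow> P V)"
proof -
  have "\<exists>C\<in>\<W>. principal {V \<in> opens X. C \<subseteq> V}
          \<le> inf (principal {V \<in> opens X. A \<subseteq> V}) (principal {V \<in> opens X. B \<subseteq> V})"
    if "A \<in> \<W>" "B \<in> \<W>" for A B
    using that assms by (intro bexI[of _ "A \<union> B"]) (auto simp: open_ideal_def)
  moreover have "\<W> \<noteq> {}"
    using assms by (auto simp: open_ideal_def)
  ultimately have "eventually P (superset_filter X \<W>) \<longleftrightarrow>
      (\<exists>W\<in>\<W>. eventually P (principal {V \<in> opens X. W \<subseteq> V}))"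
    unfolding superset_filter_def by (intro eventually_INF_base)
  then show ?thesis
    unfolding eventually_principal by blast
qed

lemma complement_filter_le: "open_ideal X \<W> \<Longrightarrow> complement_filter X \<W> \<le> principal (topspace X)"
  by (auto simp: le_principal eventually_complement_filter open_ideal_def)

text \<open>
  Each \<open>W\<close> in the ideal is itself a member of the basic set that it generates, which makes the
  filter proper even when the ideal contains the whole space.
\<close>

lemma superset_filter_in_filters_on:
  assumes "open_ideal X \<W>"
  shows "superset_filter X \<W> \<in> filters_on (opens X)"
proof -
  have "superset_filter X \<W> \<noteq> bot"
    using assms unfolding trivial_limit_def[symmetric]
    by (subst eventually_False[symmetric], subst eventually_superset_filter)
       (auto simp: open_ideal_def)
  moreover have "superset_filter X \<W> \<le> principal (opens X)"
    using assms by (auto simp: le_principal eventually_superset_filter open_ideal_def)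
  ultimately show ?thesis
    by (simp add: filters_on_def)
qed

lemma avoided_complement_filter:
  assumes I: "open_ideal X \<W>"
  shows "avoided X (complement_filter X \<W>) = \<W>"
proof (intro equalityI subsetI)
  fix V assume "V \<in> avoided X (complement_filter X \<W>)"
  then obtain W where W: "openin X V" "W \<in> \<W>" "\<forall>y\<in>topspace X - W. y \<notin> V"
    by (auto simp: avoided_def eventually_complement_filter[OF I])
  then have "V \<subseteq> W"
    using openin_subset[of X V] by blast
  with W I show "V \<in> \<W>"
    unfolding open_ideal_def by blast
next
  fix V assume "V \<in> \<W>"
  then show "V \<in> avoided X (complement_filter X \<W>)"
    using I by (auto simp: avoided_def eventually_complement_filter[OF I] open_ideal_def opens_def)
qed

lemma minorants_superset_filter:
  assumes I: "open_ideal X \<W>"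
  shows "minorants X (superset_filter X \<W>) = \<W>"
proof (intro equalityI subsetI)
  fix V assume "V \<in> minorants X (superset_filter X \<W>)"
  then obtain W where W: "openin X V" "W \<in> \<W>" "\<forall>B\<in>opens X. W \<subseteq> B \<longrightarrow> V \<subseteq> B"
    by (auto simp: minorants_def eventually_superset_filter[OF I])
  then have "V \<subseteq> W"
    using I unfolding open_ideal_def by blast
  with W I show "V \<in> \<W>"
    unfolding open_ideal_def by blast
next
  fix V assume "V \<in> \<W>"
  then show "V \<in> minorants X (superset_filter X \<W>)"
    using I by (auto simp: minorants_def eventually_superset_filter[OF I] open_ideal_def opens_def)
qed

section \<open>Ideals of infima and of contours\<close>

lemma avoided_Sup:
  "W \<in> avoided X (Sup \<H>) \<longleftrightarrow> openin X W \<and> (\<forall>H\<in>\<H>. W \<in> avoided X H)"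
  by (auto simp: avoided_def eventually_Sup)

lemma contour_filter_le:
  assumes "F \<in> filters_on Y" "selection Y L S"
  shows "contour_filter Y S F \<le> principal Y"
proof -
  have "Y \<in> filter_sets Y F"
    using assms(1) by (simp add: filters_on_def filter_sets_def le_principal)
  then have "contour_filter Y S F \<le> (SUP y\<in>Y. S y)"
    unfolding contour_filter_def by (rule INF_lower)
  also have "\<dots> \<le> principal Y"
    using assms(2) by (intro SUP_least) (auto simp: selection_def filters_on_def)
  finally show ?thesis .
qed

lemma minorants_contour_filter:
  assumes F: "F \<in> filters_on (opens X)" and S: "selection (opens X) L S"
  shows "W \<in> minorants X (contour_filter (opens X) S F) \<longleftrightarrow>
           openin X W \<and> (\<exists>A\<in>filter_sets (opens X) F. \<forall>V\<in>A. W \<in> minorants X (S V))"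
proof -
  have *: "(\<forall>\<^sub>F V in G. W \<subseteq> V) \<longleftrightarrow> {V \<in> opens X. W \<subseteq> V} \<in> filter_sets (opens X) G"
    if "G \<le> principal (opens X)" for G
    using eventually_in_carrier[OF that, of "\<lambda>V. W \<subseteq> V"]
    by (auto simp: filter_sets_def eventually_conj_iff)
  have "S V \<le> principal (opens X)" if "A \<in> filter_sets (opens X) F" "V \<in> A" for A V
    using S that by (auto simp: selection_def filters_on_def filter_sets_def)
  then show ?thesis
    unfolding minorants_def
    using *[OF contour_filter_le[OF F S]] filter_sets_contour_filter[OF F, of S] *
    by auto
qed

section \<open>Injective core compactness and diagonality\<close>

lemma injectively_core_compact_imp_diagonal:
  assumes X: "injectively_core_compact X"
  shows "diagonal (opens X) (lim_opens X)"
  unfolding diagonal_def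
proof (intro allI ballI impI)
  fix S F U
  assume S: "selection (opens X) (lim_opens X) S"
    and F: "F \<in> filters_on (opens X)" and U: "U \<in> lim_opens X F"
  have U': "openin X U" "U \<subseteq> \<Union>(minorants X F)"
    using U F by (auto simp: mem_lim_opens_iff filters_on_def)
  have "x \<in> \<Union>(minorants X (contour_filter (opens X) S F))" if "x \<in> U" for x
  proof -
    obtain W where W: "openin X W" "\<forall>\<^sub>F V in F. W \<subseteq> V" "x \<in> W"
      using U' \<open>x \<in> U\<close> by (auto simp: minorants_def)
    define A where "A = {V \<in> opens X. W \<subseteq> V}"
    have A: "A \<in> filter_sets (opens X) F"
      unfolding A_def using F W(2) by (intro eventually_in_carrier) (auto simp: filters_on_def)
    define H where "H V = complement_filter X (minorants X (S V))" for V
    have H_le: "H V \<le> principal (topspace X)" for V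
      unfolding H_def by (intro complement_filter_le open_ideal_minorants)
    have av: "avoided X (H V) = minorants X (S V)" for V
      unfolding H_def by (intro avoided_complement_filter open_ideal_minorants)
    have disj: "adh X (H V) \<inter> V = {}" if "V \<in> A" for V
    proof -
      have "V \<in> lim_opens X (S V)" "S V \<le> principal (opens X)"
        using S that by (auto simp: A_def selection_def filters_on_def)
      then have "V \<subseteq> \<Union>(minorants X (S V))"
        by (simp add: mem_lim_opens_iff)
      then show ?thesis
        using adh_eq_Diff_avoided[OF H_le[of V]] av[of V] by auto
    qed
    \<comment> \<open>The improper \<open>H V\<close> are not filters on the space. They avoid every open set, so discarding
      them does not change the infimum.\<close>
    define \<H> where "\<H> = H ` A - {bot}"
    \<comment> \<open>\<open>H\<close> may identify points of \<open>A\<close>, but any section of it is injective.\<close>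
    have \<theta>: "inv_into A H K \<in> A \<and> H (inv_into A H K) = K" if "K \<in> \<H>" for K
      using that unfolding \<H>_def by (auto intro: inv_into_into f_inv_into_f)
    have "inj_on (inv_into A H) \<H>"
      by (intro inj_onI) (metis \<theta>)
    moreover have "inv_into A H ` \<H> \<subseteq> open_nhds X W"
      using \<theta> by (auto simp: A_def open_nhds_def opens_def)
    moreover have "\<forall>K\<in>\<H>. adh X K \<inter> inv_into A H K = {}"
      using \<theta> disj by metis
    moreover have x: "x \<in> topspace X" "W \<in> open_nhds X {x}" "\<H> \<subseteq> filters_on (topspace X)"
      using W openin_subset[OF W(1)] H_le by (auto simp: open_nhds_def \<H>_def filters_on_def)
    ultimately have "x \<notin> adh X (Sup \<H>)"
      using X[unfolded injectively_core_compact_def, rule_format, OF x]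
        exI[of _ "inv_into A H"] by simp
    moreover have "Sup \<H> \<le> principal (topspace X)"
      using H_le by (auto simp: \<H>_def intro: Sup_least)
    ultimately obtain V where V: "V \<in> avoided X (Sup \<H>)" "x \<in> V"
      using x(1) by (auto simp: adh_eq_Diff_avoided)
    have "V \<in> minorants X (S B)" if "B \<in> A" for B
    proof (cases "H B = bot")
      case True
      then have "V \<in> avoided X (H B)"
        using V(1) by (simp add: avoided_def)
      then show ?thesis
        by (simp add: av)
    next
      case False
      then have "H B \<in> \<H>"
        using that by (simp add: \<H>_def)
      then show ?thesis
        using V(1) by (auto simp: avoided_Sup av)
    qed
    then have "V \<in> minorants X (contour_filter (opens X) S F)"
      using A V(1) unfolding minorants_contour_filter[OF F S] avoided_Sup by blast
    then show ?thesis
      using V(2) by blast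
  qed
  then show "U \<in> lim_opens X (contour_filter (opens X) S F)"
    using U' by (auto simp: mem_lim_opens_iff[OF contour_filter_le[OF F S]])
qed

lemma principal_in_filters_on: "A \<subseteq> Y \<Longrightarrow> A \<noteq> {} \<Longrightarrow> principal A \<in> filters_on Y"
  by (simp add: filters_on_def principal_eq_bot_iff)

lemma diagonal_imp_F1_diagonal: "diagonal Y L \<Longrightarrow> F1_diagonal Y L"
  by (simp add: diagonal_def F1_diagonal_def principal_in_filters_on)

lemma F1_diagonal_imp_injectively_core_compact:
  assumes D: "F1_diagonal (opens X) (lim_opens X)"
  shows "injectively_core_compact X"
  unfolding injectively_core_compact_def
proof (intro ballI allI impI, elim exE conjE)
  fix x U \<H> \<theta>
  assume x: "x \<in> topspace X" and U: "U \<in> open_nhds X {x}"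
    and \<H>: "\<H> \<subseteq> filters_on (topspace X)"
    and inj: "inj_on \<theta> \<H>" and \<theta>: "\<theta> ` \<H> \<subseteq> open_nhds X U"
    and disj: "\<forall>H\<in>\<H>. adh X H \<inter> \<theta> H = {}"
  have \<H>_le: "H \<le> principal (topspace X)" if "H \<in> \<H>" for H
    using \<H> that by (auto simp: filters_on_def)
  have "x \<in> \<Union>(avoided X (Sup \<H>))"
  proof (cases "\<H> = {}")
    case True
    then show ?thesis
      using x by (auto simp: avoided_def)
  next
    case False
    define A where "A = \<theta> ` \<H>"
    have A: "A \<subseteq> opens X" "A \<noteq> {}"
      using \<theta> False by (auto simp: A_def open_nhds_def opens_def)
    \<comment> \<open>Outside \<open>A\<close> any filter converging to \<open>V\<close> serves; on \<open>A\<close> the inverse of \<open>\<theta>\<close> recovers the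
      filter whose adherence misses \<open>V\<close>.\<close>
    define S where "S V = (if V \<in> A then superset_filter X (avoided X (inv_into \<H> \<theta> V))
                           else principal {V})" for V
    have S_\<theta>: "S (\<theta> H) = superset_filter X (avoided X H)" if "H \<in> \<H>" for H
      using that inj by (simp add: S_def A_def)
    have S_fil: "S V \<in> filters_on (opens X)" if "V \<in> opens X" for V
      using that unfolding S_def
      by (auto intro: superset_filter_in_filters_on open_ideal_avoided principal_in_filters_on)
    have S_min: "V \<subseteq> \<Union>(minorants X (S V))" if "V \<in> opens X" for V
    proof (cases "V \<in> A")
      case True
      then obtain H where H: "H \<in> \<H>" "V = \<theta> H"
        by (auto simp: A_def)
      have "V \<subseteq> \<Union>(avoided X H)"
        using bspec[OF disj H(1)] that openin_subset[of X V]
        unfolding H(2) adh_eq_Diff_avoided[OF \<H>_le[OF H(1)]] opens_def by blast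
      then show ?thesis
        using H by (simp add: S_\<theta> minorants_superset_filter open_ideal_avoided)
    next
      case False
      then show ?thesis
        using that by (auto simp: S_def minorants_def eventually_principal opens_def)
    qed
    have S: "selection (opens X) (lim_opens X) S"
      using S_fil S_min by (auto simp: selection_def mem_lim_opens_iff filters_on_def opens_def)
    have "U \<in> minorants X (principal A)"
      using U \<theta> by (auto simp: minorants_def eventually_principal A_def open_nhds_def)
    then have "U \<in> lim_opens X (principal A)" "U \<in> opens X"
      using A by (auto simp: mem_lim_opens_iff minorants_def opens_def)
    then have "U \<in> lim_opens X (contour_filter (opens X) S (principal A))"
      using D[unfolded F1_diagonal_def, rule_format, OF S] A by simp
    then have "U \<subseteq> \<Union>(minorants X (contour_filter (opens X) S (principal A)))"
      by (simp add: mem_lim_opens_iff contour_filter_le[OF principal_in_filters_on[OF A] S])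
    then obtain W where W: "x \<in> W" "W \<in> minorants X (contour_filter (opens X) S (principal A))"
      using U by (auto simp: open_nhds_def)
    then obtain B where B: "B \<in> filter_sets (opens X) (principal A)" "openin X W"
        "\<forall>V\<in>B. W \<in> minorants X (S V)"
      unfolding minorants_contour_filter[OF principal_in_filters_on[OF A] S] by blast
    have AB: "A \<subseteq> B"
      using B(1) by (auto simp: filter_sets_def eventually_principal)
    have "W \<in> avoided X H" if "H \<in> \<H>" for H
    proof -
      have "\<theta> H \<in> B"
        using AB that unfolding A_def by blast
      then have "W \<in> minorants X (S (\<theta> H))"
        by (rule bspec[OF B(3)])
      then show ?thesis
        unfolding S_\<theta>[OF that] minorants_superset_filter[OF open_ideal_avoided] .
    qed
    then have "W \<in> avoided X (Sup \<H>)"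
      using B(2) by (simp add: avoided_Sup)
    then show ?thesis
      using W(1) by blast
  qed
  moreover have "Sup \<H> \<le> principal (topspace X)"
    using \<H>_le by (auto intro: Sup_least)
  ultimately show "x \<notin> adh X (Sup \<H>)"
    by (simp add: adh_eq_Diff_avoided)
qed

theorem theorem19:
  fixes X :: "'a topology"
  shows "(injectively_core_compact X \<longleftrightarrow> diagonal (opens X) (lim_opens X)) \<and>
         (diagonal (opens X) (lim_opens X) \<longleftrightarrow> F1_diagonal (opens X) (lim_opens X))"
  using injectively_core_compact_imp_diagonal[of X]
    diagonal_imp_F1_diagonal[of "opens X" "lim_opens X"]
    F1_diagonal_imp_injectively_core_compact[of X]
  by argo

end
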